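(* Every recognizable tree language is the projection of a rule tree language. That is, for every recognizable tree language $L$ there are a rule tree language $L'$ over some ranked alphabet and a projection $p$ such that $L=p(L')$.
   Context: Alphabets are finite. A ranked alphabet $\Sigma$ is a finite set of symbols together with, for each $k\ge 0$, a subset $\Sigma_k\subseteq\Sigma$ (the symbols of rank $k$; a symbol may have several ranks), with $\Sigma=\bigcup_k\Sigma_k$ and only finitely many $\Sigma_k$ nonempty. The brackets $[$ and $]$ never belong to a ranked alphabet. The set $T_\Sigma$ of trees over $\Sigma$ is the smallest set of strings such that $a\in T_\Sigma$ for $a\in\Sigma_0$, and $a[t_1\cdots t_k]\in T_\Sigma$ for $k\ge1$, $a\in\Sigma_k$, $t_1,\dots,t_k\in T_\Sigma$. A tree language over $\Sigma$ is a subset of $T_\Sigma$. Recognizability: a deterministic bottom-up finite tree automaton $M=(Q,\Sigma,\delta,s,F)$ has a finite state set $Q$, a ranked alphabet $\Sigma$, maps $\delta_a^k:Q^k\to Q$ for $k\ge1$, $a\in\Sigma_k$, states $s_a\in Q$ for $a\in\Sigma_0$, and $F\subseteq Q$. Define $\widehat\delta:T_\Sigma\to Q$ by $\widehat\delta(a)=s_a$ and $\widehat\delta(a[t_1\cdots t_k])=\delta^k_a(\widehat\delta(t_1),\dots,\widehat\delta(t_k))$; $L(M)=\{t\in T_\Sigma\mid\widehat\delta(t)\in F\}$. A tree language is recognizable if it equals $L(M)$ for some such $M$. A projection $p$ from $\Sigma$ to $\Delta$ is a family of maps $p_k:\Sigma_k\to\Delta_k$ ($k\ge0$); it acts on trees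 by $p(a)=p_0(a)$ for $a\in\Sigma_0$ and $p(a[t_1\cdots t_k])=b[p(t_1)\cdots p(t_k)]$ with $b=p_k(a)$. Rule tree languages: let $G=(N,\Sigma,R,S)$ be a context-free grammar ($N$ nonterminals, $\Sigma$ terminals, $R$ finite set of rules, $S\in N$ initial nonterminal) and let $\overline R=\{\overline r\mid r\in R\}$ be any set of symbols in one-to-one correspondence with $R$, where $\overline r$ has rank $k$ (only) if $r$ has the form $A\to w_0A_1w_1\cdots A_kw_k$ with $A_i\in N$, $w_i\in\Sigma^*$. For $A\in N$ let $\mathrm{RT}_A$ be the smallest family of sets of trees over $\overline R$ such that: if $r=(A\to w_0)$ with $w_0\in\Sigma^*$, then $\overline r\in\mathrm{RT}_A$; if $r=(A\to w_0A_1w_1\cdots A_kw_k)$, $k\ge1$, and $t_i\in\mathrm{RT}_{A_i}$ for all $i$, then $\overline r[t_1\cdots t_k]\in\mathrm{RT}_A$. Then $\mathrm{RT}(G)=\mathrm{RT}_S$. A tree language is a rule tree language if it equals $\mathrm{RT}(G)$ for some context-free grammar $G$. *)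

theory Defs
  imports "HOL-Library.Countable_Set"
begin

text \<open>
  A ranked alphabet is given by its family of sets of symbols of rank \<open>k\<close>; the underlying
  set of symbols is the union of the family. The sets need not be disjoint, so a symbol may have
  several ranks.
\<close>

type_synonym 'a ranked = "nat \<Rightarrow> 'a set"

definition ranked_alphabet :: "'a ranked \<Rightarrow> bool" where
  "ranked_alphabet \<Gamma> \<longleftrightarrow> finite (\<Union>k. \<Gamma> k) \<and> finite {k. \<Gamma> k \<noteq> {}}"

text \<open>
  \<open>Node a []\<close> stands for the string \<open>a\<close>, and \<open>Node a [t\<^sub>1, \<dots>, t\<^sub>k]\<close> with \<open>k \<ge> 1\<close> for the string
  \<open>a[t\<^sub>1\<cdots>t\<^sub>k]\<close>. The bracket symbols are not elements of \<open>'a\<close>; \<open>inj_string_of\<close> below shows that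
  the string determines the tree.
\<close>

datatype 'a tree = Node 'a "'a tree list"

datatype 'a bracketed = Sym 'a | LBr | RBr

fun string_of :: "'a tree \<Rightarrow> 'a bracketed list" where
  "string_of (Node a ts) =
     (if ts = [] then [Sym a] else Sym a # LBr # concat (map string_of ts) @ [RBr])"

lemma string_of_prefix_unique:
  "string_of t @ u = string_of t' @ u' \<Longrightarrow> (u = [] \<or> hd u \<noteq> LBr) \<Longrightarrow> (u' = [] \<or> hd u' \<noteq> LBr)
   \<Longrightarrow> t = t' \<and> u = u'"
proof (induction t arbitrary: t' u u')
  case (Node a ts)
  obtain b ts' where t': "t' = Node b ts'" by (cases t')
  have hd_neq: "concat (map string_of vs) @ RBr # v \<noteq> [] \<and>
      hd (concat (map string_of vs) @ RBr # v) \<noteq> LBr" for vs :: "'a tree list" and v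
  proof (cases vs)
    case (Cons w ws) then show ?thesis by (cases w) auto
  qed auto
  have Sym_neq: "string_of w @ v \<noteq> RBr # v'" for w :: "'a tree" and v v'
    by (cases w) auto
  have lists: "vs = vs' \<and> v = v'"
    if "concat (map string_of vs) @ RBr # v = concat (map string_of vs') @ RBr # v'"
       "set vs \<subseteq> set ts" for vs vs' v v'
    using that
  proof (induction vs arbitrary: vs')
    case Nil
    then show ?case
      using Sym_neq by (cases vs') (auto, metis)
  next
    case (Cons w ws)
    show ?case
    proof (cases vs')
      case Nil
      then show ?thesis using Cons.prems Sym_neq by auto
    next
      case (Cons w' ws')
      have "string_of w @ (concat (map string_of ws) @ RBr # v) =
            string_of w' @ (concat (map string_of ws') @ RBr # v')"
        using Cons.prems Cons by simp
      then have "w = w' \<and> concat (map string_of ws) @ RBr # v =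
          concat (map string_of ws') @ RBr # v'"
        using Node.IH[of w] Cons.prems(2) hd_neq by (metis list.set_intros(1) subsetD)
      then show ?thesis using Cons.IH[of ws'] Cons.prems(2) Cons by simp
    qed
  qed
  show ?case
  proof (cases "ts = [] \<or> ts' = []")
    case True
    then show ?thesis using Node.prems t' by (auto split: if_splits)
  next
    case False
    then show ?thesis using Node.prems(1) t' lists[of ts u ts' u'] by simp
  qed
qed

lemma inj_string_of: "inj string_of"
  using string_of_prefix_unique[of _ "[]" _ "[]"] by (auto intro!: injI)

inductive_set trees :: "'a ranked \<Rightarrow> 'a tree set" for \<Gamma> :: "'a ranked" where
  "a \<in> \<Gamma> (length ts) \<Longrightarrow> (\<And>t. t \<in> set ts \<Longrightarrow> t \<in> trees \<Gamma>) \<Longrightarrow> Node a ts \<in> trees \<Gamma>"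

text \<open>
  \<open>step M a [q\<^sub>1, \<dots>, q\<^sub>k]\<close> is the value of the map usually written with the rank \<open>k\<close> as an
  additional index. The rank is the length of the list, and only lists of length at least 1 are
  used: symbols of rank 0 are read with \<open>leaf\<close>.
\<close>

record ('q, 'a) fta =
  states :: "'q set"
  alphabet :: "'a ranked"
  step :: "'a \<Rightarrow> 'q list \<Rightarrow> 'q"
  leaf :: "'a \<Rightarrow> 'q"
  final :: "'q set"

definition det_fta :: "('q, 'a) fta \<Rightarrow> bool" where
  "det_fta M \<longleftrightarrow>
     finite (states M) \<and> ranked_alphabet (alphabet M) \<and>
     (\<forall>k\<ge>1. \<forall>a\<in>alphabet M k. \<forall>qs. length qs = k \<longrightarrow> set qs \<subseteq> states M \<longrightarrow> step M a qs \<in> states M) \<and>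
     (\<forall>a\<in>alphabet M 0. leaf M a \<in> states M) \<and>
     final M \<subseteq> states M"

fun run :: "('q, 'a) fta \<Rightarrow> 'a tree \<Rightarrow> 'q" where
  "run M (Node a ts) = (if ts = [] then leaf M a else step M a (map (run M) ts))"

definition lang :: "('q, 'a) fta \<Rightarrow> 'a tree set" where
  "lang M = {t \<in> trees (alphabet M). run M t \<in> final M}"

text \<open>
  Since state sets are finite, states can be taken to be natural numbers; \<open>recognizableI\<close> shows
  that automata with states of any other type give nothing more.
\<close>

definition recognizable :: "'a ranked \<Rightarrow> 'a tree set \<Rightarrow> bool" where
  "recognizable \<Gamma> L \<longleftrightarrow> (\<exists>M :: (nat, 'a) fta. det_fta M \<and> alphabet M = \<Gamma> \<and> L = lang M)"

lemma recognizableI: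
  fixes M :: "('q, 'a) fta"
  assumes M: "det_fta M"
  shows "recognizable (alphabet M) (lang M)"
proof -
  define f where "f = to_nat_on (states M)"
  have inj: "inj_on f (states M)"
    using M by (auto simp: det_fta_def f_def intro: inj_on_to_nat_on countable_finite)
  let ?g = "inv_into (states M) f"
  define M' where "M' = \<lparr>states = f ` states M, alphabet = alphabet M,
    step = (\<lambda>a qs. f (step M a (map ?g qs))), leaf = f \<circ> leaf M, final = f ` final M\<rparr>"
  have step': "step M' a qs = f (step M a (map ?g qs))" for a qs
    by (simp add: M'_def)
  have step: "step M a qs \<in> states M"
    if "Suc 0 \<le> length qs" "a \<in> alphabet M (length qs)" "set qs \<subseteq> states M" for a qs
    using M that unfolding det_fta_def by (metis One_nat_def)
  have run: "run M t \<in> states M \<and> run M' t = f (run M t)" if "t \<in> trees (alphabet M)" for t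
    using that
  proof induction
    case (1 a ts)
    have m: "map (?g \<circ> run M') ts = map (run M) ts"
      using 1 inj by auto
    show ?case
    proof (cases "ts = []")
      case True
      then show ?thesis using M 1 by (auto simp: det_fta_def M'_def)
    next
      case False
      have "Suc 0 \<le> length ts" using False by (simp add: Suc_le_eq)
      moreover have "set (map (run M) ts) \<subseteq> states M" using 1 by auto
      ultimately have "step M a (map (run M) ts) \<in> states M"
        using step 1(1) by simp
      moreover have "run M' (Node a ts) = f (step M a (map (?g \<circ> run M') ts))"
        using False by (simp add: step')
      ultimately show ?thesis using False m by simp
    qed
  qed
  have "step M a (map ?g qs) \<in> states M"
    if "Suc 0 \<le> length qs" "a \<in> alphabet M (length qs)" "set qs \<subseteq> f ` states M" for a qs
  proof -
    have "set (map ?g qs) \<subseteq> states M" using that(3) by (auto intro!: inv_into_into)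
    then show ?thesis using step that by simp
  qed
  then have "det_fta M'"
    using M by (auto simp: det_fta_def M'_def)
  moreover have "lang M' = lang M"
  proof -
    have "f (run M t) \<in> f ` final M \<longleftrightarrow> run M t \<in> final M" if "t \<in> trees (alphabet M)" for t
      using run[OF that] inj M unfolding det_fta_def by (meson inj_on_image_mem_iff)
    moreover have "alphabet M' = alphabet M" "final M' = f ` final M" by (simp_all add: M'_def)
    ultimately show ?thesis
      unfolding lang_def using run by (metis (no_types, lifting))
  qed
  moreover have "alphabet M' = alphabet M" by (simp add: M'_def)
  ultimately show ?thesis unfolding recognizable_def by metis
qed

definition projection :: "'b ranked \<Rightarrow> 'a ranked \<Rightarrow> (nat \<Rightarrow> 'b \<Rightarrow> 'a) \<Rightarrow> bool" where
  "projection \<Delta> \<Gamma> p \<longleftrightarrow>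
     ranked_alphabet \<Delta> \<and> ranked_alphabet \<Gamma> \<and> (\<forall>k. \<forall>b\<in>\<Delta> k. p k b \<in> \<Gamma> k)"

fun proj_tree :: "(nat \<Rightarrow> 'b \<Rightarrow> 'a) \<Rightarrow> 'b tree \<Rightarrow> 'a tree" where
  "proj_tree p (Node b ts) = Node (p (length ts) b) (map (proj_tree p) ts)"

text \<open>
  A rule \<open>A \<rightarrow> w\<close> is a pair \<open>(A, w)\<close>; in \<open>w\<close>, nonterminals are tagged with \<open>Inl\<close> and terminals
  with \<open>Inr\<close>, which makes the two alphabets disjoint.
\<close>

type_synonym ('n, 't) cfg_rule = "'n \<times> ('n + 't) list"

record ('n, 't) cfg =
  nonterminals :: "'n set"
  terminals :: "'t set"
  rules :: "('n, 't) cfg_rule set"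
  initial :: 'n

definition context_free :: "('n, 't) cfg \<Rightarrow> bool" where
  "context_free G \<longleftrightarrow>
     finite (nonterminals G) \<and> finite (terminals G) \<and> finite (rules G) \<and>
     initial G \<in> nonterminals G \<and>
     (\<forall>(A, w)\<in>rules G. A \<in> nonterminals G \<and> set w \<subseteq> nonterminals G <+> terminals G)"

text \<open>For \<open>w = w\<^sub>0A\<^sub>1w\<^sub>1\<cdots>A\<^sub>kw\<^sub>k\<close> with terminal strings \<open>w\<^sub>i\<close>, \<open>nts w\<close> is the list \<open>[A\<^sub>1, \<dots>, A\<^sub>k]\<close>.\<close>

definition nts :: "('n + 't) list \<Rightarrow> 'n list" where
  "nts w = map projl (filter isl w)"

text \<open>
  The map \<open>bar\<close> assigns to each rule its symbol; it is required to be injective on the rules in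
  \<open>rule_tree_language\<close>.
\<close>

definition rule_alphabet :: "('n, 't) cfg \<Rightarrow> (('n, 't) cfg_rule \<Rightarrow> 'b) \<Rightarrow> 'b ranked" where
  "rule_alphabet G bar k = {bar (A, w) | A w. (A, w) \<in> rules G \<and> length (nts w) = k}"

inductive rule_tree ::
  "('n, 't) cfg \<Rightarrow> (('n, 't) cfg_rule \<Rightarrow> 'b) \<Rightarrow> 'n \<Rightarrow> 'b tree \<Rightarrow> bool" for G bar where
  "(A, w) \<in> rules G \<Longrightarrow> list_all2 (rule_tree G bar) (nts w) ts
   \<Longrightarrow> rule_tree G bar A (Node (bar (A, w)) ts)"

definition RT :: "('n, 't) cfg \<Rightarrow> (('n, 't) cfg_rule \<Rightarrow> 'b) \<Rightarrow> 'b tree set" where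
  "RT G bar = {t. rule_tree G bar (initial G) t}"

text \<open>
  \<open>\<Delta>\<close> is the ranked alphabet of rule symbols. As for states, taking nonterminals and terminals to
  be natural numbers is no restriction (\<open>rule_tree_languageI\<close>).
\<close>

definition rule_tree_language :: "'b ranked \<Rightarrow> 'b tree set \<Rightarrow> bool" where
  "rule_tree_language \<Delta> L \<longleftrightarrow>
     (\<exists>(G :: (nat, nat) cfg) bar. context_free G \<and> inj_on bar (rules G) \<and>
        \<Delta> = rule_alphabet G bar \<and> L = RT G bar)"

lemma nts_map_sum: "nts (map (map_sum f g) w) = map f (nts w)"
proof (induction w)
  case (Cons x w) then show ?case by (cases x) (auto simp: nts_def)
qed (simp add: nts_def)

lemma set_nts: "set w \<subseteq> N <+> T \<Longrightarrow> set (nts w) \<subseteq> N"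
  by (auto simp: nts_def)

lemma rule_tree_languageI:
  fixes G :: "('n, 't) cfg" and bar :: "('n, 't) cfg_rule \<Rightarrow> 'b"
  assumes G: "context_free G" and bar: "inj_on bar (rules G)"
  shows "rule_tree_language (rule_alphabet G bar) (RT G bar)"
proof -
  define f where "f = to_nat_on (nonterminals G)"
  define g where "g = to_nat_on (terminals G)"
  have f: "inj_on f (nonterminals G)" and g: "inj_on g (terminals G)"
    using G by (auto simp: context_free_def f_def g_def intro: inj_on_to_nat_on countable_finite)
  define h where "h = (\<lambda>(A, w). (f A, map (map_sum f g) w))"
  have rules: "A \<in> nonterminals G" "set w \<subseteq> nonterminals G <+> terminals G"
    if "(A, w) \<in> rules G" for A w
    using G that by (auto simp: context_free_def)
  have inj_sum: "inj_on (map_sum f g) (nonterminals G <+> terminals G)"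
    by (rule inj_onI) (use f g in \<open>auto dest: inj_onD\<close>)
  have h: "inj_on h (rules G)"
  proof (rule inj_onI, clarify)
    fix A w B v assume *: "(A, w) \<in> rules G" "(B, v) \<in> rules G" "h (A, w) = h (B, v)"
    then have "A = B" using f rules by (auto simp: h_def inj_on_def)
    moreover have "w = v"
      using * rules[OF *(1)] rules[OF *(2)] inj_sum
      by (auto simp: h_def intro!: map_inj_on[of "map_sum f g"] elim: inj_on_subset)
    ultimately show "A = B \<and> w = v" by simp
  qed
  define G' where "G' = \<lparr>nonterminals = f ` nonterminals G, terminals = g ` terminals G,
    rules = h ` rules G, initial = f (initial G)\<rparr>"
  define bar' where "bar' = bar \<circ> inv_into (rules G) h"
  have bar': "bar' (h r) = bar r" if "r \<in> rules G" for r
    using h that by (simp add: bar'_def)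
  have cf: "context_free G'"
    using G rules unfolding context_free_def
    by (fastforce simp: G'_def h_def)
  have inj: "inj_on bar' (rules G')"
    using bar bar' by (auto simp: G'_def inj_on_def)
  have "rule_alphabet G' bar' k = rule_alphabet G bar k" for k
  proof -
    have "rule_alphabet G' bar' k = bar' ` {r \<in> rules G'. length (nts (snd r)) = k}"
      by (force simp: rule_alphabet_def)
    also have "\<dots> = bar' ` h ` {r \<in> rules G. length (nts (snd r)) = k}"
      by (rule arg_cong[of _ _ "image bar'"]) (force simp: G'_def h_def nts_map_sum)
    also have "\<dots> = bar ` {r \<in> rules G. length (nts (snd r)) = k}"
      unfolding image_image by (rule image_cong) (auto simp: bar')
    also have "\<dots> = rule_alphabet G bar k"
      by (force simp: rule_alphabet_def)
    finally show ?thesis .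
  qed
  then have alph: "rule_alphabet G' bar' = rule_alphabet G bar" by blast
  have fwd: "rule_tree G' bar' (f A) t" if "rule_tree G bar A t" for A t
    using that
  proof induction
    case (1 A w ts)
    have "list_all2 (rule_tree G' bar') (nts (map (map_sum f g) w)) ts"
      unfolding nts_map_sum list_all2_map1 using 1(2) by (auto elim: list_all2_mono)
    moreover have "(f A, map (map_sum f g) w) \<in> rules G'"
      using imageI[OF 1(1), of h] by (simp add: G'_def h_def)
    ultimately have "rule_tree G' bar' (f A) (Node (bar' (h (A, w))) ts)"
      using rule_tree.intros by (fastforce simp: h_def)
    then show ?case using bar'[OF 1(1)] by simp
  qed
  have bwd: "\<forall>A\<in>nonterminals G. B = f A \<longrightarrow> rule_tree G bar A t" if "rule_tree G' bar' B t" for B t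
    using that
  proof induction
    case (1 B v ts)
    then obtain A w where r: "(A, w) \<in> rules G" "B = f A" "v = map (map_sum f g) w"
      by (auto simp: G'_def h_def)
    have N: "set (nts w) \<subseteq> nonterminals G" using set_nts rules(2)[OF r(1)] by blast
    have IH: "list_all2 (\<lambda>x t. rule_tree G' bar' (f x) t \<and>
        (\<forall>A\<in>nonterminals G. f x = f A \<longrightarrow> rule_tree G bar A t)) (nts w) ts"
      using 1(2) unfolding r(3) nts_map_sum list_all2_map1 .
    have "list_all2 (rule_tree G bar) (nts w) ts"
      by (rule list.rel_mono_strong[OF IH]) (use N in blast)
    then have "rule_tree G bar A (Node (bar (A, w)) ts)"
      by (rule rule_tree.intros[OF r(1)])
    moreover have "bar' (B, v) = bar (A, w)" using bar'[OF r(1)] r by (simp add: h_def)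
    ultimately have "rule_tree G bar A (Node (bar' (B, v)) ts)" by simp
    moreover have "C = A" if "C \<in> nonterminals G" "B = f C" for C
      using inj_onD[OF f] rules(1)[OF r(1)] r(2) that by metis
    ultimately show ?case by blast
  qed
  have "initial G \<in> nonterminals G" using G by (simp add: context_free_def)
  then have "RT G' bar' = RT G bar"
    using fwd bwd by (auto simp: RT_def G'_def)
  then show ?thesis unfolding rule_tree_language_def using cf inj alph by metis
qed

end

theory Submission
  imports Defs
begin

text \<open>
  Given an automaton \<open>M\<close>, take the grammar with rules \<open>q \<rightarrow> a q\<^sub>1 \<cdots> q\<^sub>k\<close> for every transition
  \<open>\<delta>\<^sub>a(q\<^sub>1, \<dots>, q\<^sub>k) = q\<close>, together with a fresh initial nonterminal that
  copies the rules of the final states. A rule tree with root nonterminal \<open>q\<close> is then a tree over the alphabet of \<open>M\<close>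
  decorated with its run, which ends in \<open>q\<close>, and the projection sends the rule to \<open>a\<close>.
\<close>

text \<open>Merging \<open>leaf\<close> with \<open>step\<close> lets rank 0 share one argument with
  all other ranks.\<close>

definition target :: "('q, 'a) fta \<Rightarrow> 'a \<Rightarrow> 'q list \<Rightarrow> 'q" where
  "target M a qs = (if qs = [] then leaf M a else step M a qs)"

lemma run_Node: "run M (Node a ts) = target M a (map (run M) ts)"
  by (simp add: target_def)

lemma target_in_states:
  assumes "det_fta M" "a \<in> alphabet M (length qs)" "set qs \<subseteq> states M"
  shows "target M a qs \<in> states M"
proof (cases "qs = []")
  case True
  then show ?thesis using assms by (simp add: target_def det_fta_def)
next
  case False
  then have "length qs \<ge> 1" by (simp add: Suc_le_eq)
  then show ?thesis using assms False unfolding det_fta_def target_def by metis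
qed

lemma run_in_states:
  assumes "det_fta M" "t \<in> trees (alphabet M)"
  shows "run M t \<in> states M"
  using assms(2)
proof induction
  case (1 a ts)
  then show ?case unfolding run_Node by (intro target_in_states assms(1)) auto
qed

definition transitions :: "('q, 'a) fta \<Rightarrow> ('a \<times> 'q list) set" where
  "transitions M = {(a, qs). set qs \<subseteq> states M \<and> a \<in> alphabet M (length qs)}"

text \<open>Only finitely many ranks occur, so the state lists have bounded length over a finite
  set.\<close>

lemma finite_transitions:
  assumes "det_fta M"
  shows "finite (transitions M)"
proof -
  have fin: "finite (states M)" "finite (\<Union>k. alphabet M k)" "finite {k. alphabet M k \<noteq> {}}"
    using assms by (auto simp: det_fta_def ranked_alphabet_def)
  obtain n where n: "{k. alphabet M k \<noteq> {}} \<subseteq> {..n}"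
    using fin(3) finite_nat_iff_bounded_le by blast
  have "transitions M \<subseteq> (\<Union>k. alphabet M k) \<times> {qs. set qs \<subseteq> states M \<and> length qs \<le> n}"
    using n by (auto simp: transitions_def)
  then show ?thesis
    using finite_lists_length_le[OF fin(1)] fin(2) by (meson finite_SigmaI finite_subset)
qed

text \<open>The leading terminal keeps apart transitions that agree on all their states and lets the
  symbol be read off the rule. \<open>None\<close> is the fresh initial nonterminal and never occurs
  here.\<close>

definition rhs :: "'a \<Rightarrow> 'q list \<Rightarrow> ('q option + 'a) list" where
  "rhs a qs = Inr a # map (Inl \<circ> Some) qs"

lemma nts_rhs: "nts (rhs a qs) = map Some qs"
  by (induction qs) (auto simp: nts_def rhs_def)

definition rule_symbol :: "('q option, 'a) cfg_rule \<Rightarrow> 'a" where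
  "rule_symbol r = projr (hd (snd r))"

lemma rule_symbol_rhs [simp]: "rule_symbol (A, rhs a qs) = a"
  by (simp add: rule_symbol_def rhs_def)

text \<open>The root states allowed for trees derived from a nonterminal; this treats
  \<open>None\<close> and \<open>Some q\<close> uniformly.\<close>

definition accepted :: "('q, 'a) fta \<Rightarrow> 'q option \<Rightarrow> 'q set" where
  "accepted M A = (case A of None \<Rightarrow> final M | Some q \<Rightarrow> {q})"

definition fta_cfg :: "('q, 'a) fta \<Rightarrow> ('q option, 'a) cfg" where
  "fta_cfg M = \<lparr>nonterminals = insert None (Some ` states M), terminals = (\<Union>k. alphabet M k),
     rules = {(A, rhs a qs) | A a qs. (a, qs) \<in> transitions M \<and>
       A \<in> insert None (Some ` states M) \<and> target M a qs \<in> accepted M A},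
     initial = None\<rparr>"

lemma context_free_fta_cfg:
  assumes "det_fta M"
  shows "context_free (fta_cfg M)"
proof -
  have fin: "finite (states M)" "finite (\<Union>k. alphabet M k)"
    using assms by (auto simp: det_fta_def ranked_alphabet_def)
  have "rules (fta_cfg M) \<subseteq> insert None (Some ` states M) \<times> (\<lambda>(a, qs). rhs a qs) ` transitions M"
    by (auto simp: fta_cfg_def)
  then have "finite (rules (fta_cfg M))"
    using fin(1) finite_transitions[OF assms] by (meson finite_SigmaI finite_imageI finite_insert finite_subset)
  moreover have "A \<in> insert None (Some ` states M) \<and>
      set w \<subseteq> insert None (Some ` states M) <+> (\<Union>k. alphabet M k)"
    if "(A, w) \<in> rules (fta_cfg M)" for A w
    using that by (auto 0 4 simp: fta_cfg_def transitions_def rhs_def)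
  ultimately show ?thesis
    using fin unfolding context_free_def by (auto simp: fta_cfg_def)
qed

lemma rule_tree_fta_cfg:
  fixes p :: "nat \<Rightarrow> 'b \<Rightarrow> 'a"
  assumes "rule_tree (fta_cfg M) bar A t"
    and p: "\<And>k r. r \<in> rules (fta_cfg M) \<Longrightarrow> p k (bar r) = rule_symbol r"
  shows "proj_tree p t \<in> trees (alphabet M) \<and> run M (proj_tree p t) \<in> accepted M A"
  using assms(1)
proof induction
  case (1 A w ts)
  obtain a qs where r: "w = rhs a qs" "(a, qs) \<in> transitions M" "target M a qs \<in> accepted M A"
    using 1(1) by (auto simp: fta_cfg_def)
  \<comment> \<open>The children hang below nonterminals \<open>Some q\<close>, where
    \<open>accepted\<close> is a singleton, so the induction hypothesis fixes their states
    exactly.\<close>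
  have sub: "list_all2 (\<lambda>q t. proj_tree p t \<in> trees (alphabet M) \<and> run M (proj_tree p t) = q) qs ts"
    using 1(2) unfolding r(1) nts_rhs list_all2_map1
    by (auto simp: accepted_def elim: list_all2_mono)
  then have len: "length ts = length qs" and runs: "map (run M) (map (proj_tree p) ts) = qs"
    and trees: "\<And>t. t \<in> set ts \<Longrightarrow> proj_tree p t \<in> trees (alphabet M)"
    by (auto simp: list_all2_conv_all_nth in_set_conv_nth intro!: nth_equalityI)
  have "proj_tree p (Node (bar (A, w)) ts) = Node a (map (proj_tree p) ts)"
    using p[OF 1(1)] r(1) by simp
  moreover have "Node a (map (proj_tree p) ts) \<in> trees (alphabet M)"
    using r(2) len trees by (intro trees.intros) (auto simp: transitions_def)
  ultimately show ?case
    using r(3) runs run_Node by metis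
qed

text \<open>Decorating each node with the transition used there gives the rule tree. The induction
  keeps \<open>A\<close> arbitrary, since the root may carry \<open>None\<close> while every subtree
  needs \<open>Some\<close> of its own state.\<close>

lemma rule_tree_over_run:
  fixes p :: "nat \<Rightarrow> 'b \<Rightarrow> 'a"
  assumes M: "det_fta M"
    and p: "\<And>k r. r \<in> rules (fta_cfg M) \<Longrightarrow> p k (bar r) = rule_symbol r"
    and "t \<in> trees (alphabet M)" "A \<in> insert None (Some ` states M)" "run M t \<in> accepted M A"
  shows "\<exists>t'. rule_tree (fta_cfg M) bar A t' \<and> proj_tree p t' = t"
  using assms(3-5)
proof (induction arbitrary: A)
  case (1 a ts)
  let ?qs = "map (run M) ts"
  have "\<exists>t'. rule_tree (fta_cfg M) bar (Some (run M t)) t' \<and> proj_tree p t' = t" if "t \<in> set ts" for t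
    using 1(3)[OF that, of "Some (run M t)"] run_in_states[OF M 1(2)[OF that]] by (simp add: accepted_def)
  then obtain f where f: "\<And>t. t \<in> set ts \<Longrightarrow> rule_tree (fta_cfg M) bar (Some (run M t)) (f t) \<and> proj_tree p (f t) = t"
    by metis
  have "(a, ?qs) \<in> transitions M"
    using 1(1,2) run_in_states[OF M] by (auto simp: transitions_def)
  then have r: "(A, rhs a ?qs) \<in> rules (fta_cfg M)"
    using 1(4,5) unfolding run_Node by (auto simp: fta_cfg_def)
  have "rule_tree (fta_cfg M) bar A (Node (bar (A, rhs a ?qs)) (map f ts))"
    by (rule rule_tree.intros[OF r])
       (use f in \<open>simp add: nts_rhs list_all2_map1 list_all2_map2 list_all2_same\<close>)
  moreover have "proj_tree p (Node (bar (A, rhs a ?qs)) (map f ts)) = Node a ts"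
    using f p[OF r] by (simp add: map_idI)
  ultimately show ?case by blast
qed

text \<open>The two inclusions are the two preceding lemmas at \<open>None\<close>, where acceptance
  means ending in a final state.\<close>

lemma proj_tree_RT_fta_cfg:
  fixes p :: "nat \<Rightarrow> 'b \<Rightarrow> 'a"
  assumes "det_fta M"
    and "\<And>k r. r \<in> rules (fta_cfg M) \<Longrightarrow> p k (bar r) = rule_symbol r"
  shows "proj_tree p ` RT (fta_cfg M) bar = lang M"
proof -
  have init: "initial (fta_cfg M) = None" "accepted M None = final M"
    by (simp_all add: fta_cfg_def accepted_def)
  show ?thesis
    using rule_tree_fta_cfg[of M bar None _ p, OF _ assms(2)] rule_tree_over_run[of M p bar _ None, OF assms]
    by (auto simp: RT_def lang_def init)
qed

theorem theorem3p58:
  fixes \<Gamma> :: "'a ranked" and L :: "'a tree set"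
  assumes "recognizable \<Gamma> L"
  shows "\<exists>(\<Delta> :: nat ranked) L' p.
           rule_tree_language \<Delta> L' \<and> projection \<Delta> \<Gamma> p \<and> L = proj_tree p ` L'"
proof -
  obtain M :: "(nat, 'a) fta" where M: "det_fta M" "alphabet M = \<Gamma>" "L = lang M"
    using assms by (auto simp: recognizable_def)
  let ?R = "rules (fta_cfg M)"
  \<comment> \<open>Numbering the finitely many rules makes the rule symbols natural numbers;
    \<open>p\<close> decodes such a number and returns the terminal of its rule, whatever the
    rank.\<close>
  define bar where "bar = to_nat_on ?R"
  define p where "p = (\<lambda>k :: nat. rule_symbol \<circ> inv_into ?R bar)"
  have cf: "context_free (fta_cfg M)" by (rule context_free_fta_cfg[OF M(1)])
  then have fin: "finite ?R" by (simp add: context_free_def)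
  then have inj: "inj_on bar ?R"
    by (auto simp: bar_def intro: inj_on_to_nat_on countable_finite)
  then have p: "p k (bar r) = rule_symbol r" if "r \<in> ?R" for k r
    using that by (simp add: p_def)
  let ?\<Delta> = "rule_alphabet (fta_cfg M) bar"
  have "(\<Union>k. ?\<Delta> k) \<subseteq> bar ` ?R" "{k. ?\<Delta> k \<noteq> {}} \<subseteq> (\<lambda>r. length (nts (snd r))) ` ?R"
    by (force simp: rule_alphabet_def)+
  then have "ranked_alphabet ?\<Delta>"
    unfolding ranked_alphabet_def using fin by (meson finite_imageI finite_subset)
  \<comment> \<open>Ranks are preserved because the right-hand side built from \<open>qs\<close> has
    exactly \<open>length qs\<close> nonterminals.\<close>
  moreover have "p k b \<in> \<Gamma> k" if b: "b \<in> ?\<Delta> k" for k b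
  proof -
    obtain A w where r: "b = bar (A, w)" "(A, w) \<in> ?R" "length (nts w) = k"
      using b by (auto simp: rule_alphabet_def)
    then obtain a qs where "w = rhs a qs" "(a, qs) \<in> transitions M"
      by (auto simp: fta_cfg_def)
    then show ?thesis using r p M(2) by (simp add: nts_rhs transitions_def)
  qed
  moreover have "ranked_alphabet \<Gamma>" using M by (auto simp: det_fta_def)
  ultimately have "projection ?\<Delta> \<Gamma> p" by (simp add: projection_def)
  moreover have "L = proj_tree p ` RT (fta_cfg M) bar"
    using proj_tree_RT_fta_cfg[OF M(1), of p bar] p M(3) by simp
  \<comment> \<open>\<open>rule_tree_languageI\<close> replaces the nonterminals
    \<open>nat option\<close> and the terminals \<open>'a\<close> by natural numbers.\<close>
  ultimately show ?thesis
    using rule_tree_languageI[OF cf inj] by blast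
qed

end
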